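(* Let $m$ and $\gamma$ be integers with $m\ge0$ and $\gamma<m+1$. The hyperbolic series $$S^{(\gamma)}_{2m+2}(\phi)=\sum_{n=1}^\infty \frac{\phi^{2m+2}\cosh^\gamma(n\phi)}{\sinh^{2m+2}(n\phi/2)},\quad S^{(\sinh,\gamma)}_{2m+2}(\phi)=\sum_{n=1}^\infty \frac{\phi^{2m+2}\sinh^\gamma(n\phi)}{\sinh^{2m+2}(n\phi/2)},\quad S_{2m+2}(\phi)=\sum_{n=1}^\infty \frac{\phi^{2m+2}}{\sinh^{2m+2}(n\phi/2)}$$ are analytic functions of $\phi$ in the complex plane except the imaginary axis. The hyperbolic series are continuous functions on the real axis.
   Context: The real axis includes $\phi=0$. Setting $\phi$ to zero gives the values $S^{(\gamma)}_{2m+2}(0)=S_{2m+2}(0)=\sum_{n=1}^\infty \frac{2^{2m+2}}{n^{2m+2}}=2^{2m+2}\zeta(2m+2)$ and $S^{(\sinh,\gamma)}_{2m+2}(0)=0$, where $\zeta$ is the Riemann zeta function.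
   Formalization: For γ<0 the sinh series is claimed continuous only on the real axis without φ=0, as it blows up like φ^γ there (m=0, γ=-1: the first term is ~4/φ); for γ=0 its value at φ=0 is taken as S_{2m+2}(0), not 0, since the series then equals S_{2m+2}. *)

theory Defs
  imports "HOL-Analysis.Analysis"
begin

text \<open>
  The summands of the three series, for \<open>n \<ge> 1\<close>. At \<open>\<phi> = 0\<close> the quotients have the form
  \<open>0 / 0\<close>, and the value is the limit of the summand as \<open>\<phi>\<close> tends to \<open>0\<close>, which comes from
  \<open>\<phi> / sinh (n * \<phi> / 2) \<rightarrow> 2 / n\<close>. For \<open>sinh_term\<close> this limit is \<open>0\<close> if \<open>\<gamma> > 0\<close> and \<open>(2 / n) ^ (2 * m + 2)\<close>
  if \<open>\<gamma> = 0\<close>. If \<open>\<gamma> < 0\<close>, the summand of the sinh series has a pole at \<open>0\<close>, so there is no limit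
  and the value \<open>0\<close> is a mere convention.
\<close>

definition plain_term :: "nat \<Rightarrow> nat \<Rightarrow> complex \<Rightarrow> complex" where
  "plain_term m n \<phi> =
     (if \<phi> = 0 then (2 / of_nat n) ^ (2 * m + 2)
      else \<phi> ^ (2 * m + 2) / sinh (of_nat n * \<phi> / 2) ^ (2 * m + 2))"

definition cosh_term :: "nat \<Rightarrow> int \<Rightarrow> nat \<Rightarrow> complex \<Rightarrow> complex" where
  "cosh_term m \<gamma> n \<phi> =
     (if \<phi> = 0 then (2 / of_nat n) ^ (2 * m + 2)
      else \<phi> ^ (2 * m + 2) * cosh (of_nat n * \<phi>) powi \<gamma> / sinh (of_nat n * \<phi> / 2) ^ (2 * m + 2))"

definition sinh_term :: "nat \<Rightarrow> int \<Rightarrow> nat \<Rightarrow> complex \<Rightarrow> complex" where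
  "sinh_term m \<gamma> n \<phi> =
     (if \<phi> = 0 then (if \<gamma> = 0 then (2 / of_nat n) ^ (2 * m + 2) else 0)
      else \<phi> ^ (2 * m + 2) * sinh (of_nat n * \<phi>) powi \<gamma> / sinh (of_nat n * \<phi> / 2) ^ (2 * m + 2))"

text \<open>
  \<open>S_plain m\<close>, \<open>S_cosh m \<gamma>\<close> and \<open>S_sinh m \<gamma>\<close> are the series with index \<open>2 * m + 2\<close>; the
  summation runs over \<open>Suc n\<close> because it starts at \<open>1\<close>.
\<close>

definition S_plain :: "nat \<Rightarrow> complex \<Rightarrow> complex" where
  "S_plain m \<phi> = (\<Sum>n. plain_term m (Suc n) \<phi>)"

definition S_cosh :: "nat \<Rightarrow> int \<Rightarrow> complex \<Rightarrow> complex" where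
  "S_cosh m \<gamma> \<phi> = (\<Sum>n. cosh_term m \<gamma> (Suc n) \<phi>)"

definition S_sinh :: "nat \<Rightarrow> int \<Rightarrow> complex \<Rightarrow> complex" where
  "S_sinh m \<gamma> \<phi> = (\<Sum>n. sinh_term m \<gamma> (Suc n) \<phi>)"

lemma S_plain_at_0: "S_plain m 0 = (\<Sum>n. 2 ^ (2 * m + 2) / of_nat (Suc n) ^ (2 * m + 2))"
  by (simp only: S_plain_def plain_term_def power_divide if_True simp_thms)

lemma S_cosh_at_0: "S_cosh m \<gamma> 0 = S_plain m 0"
  by (simp add: S_plain_def S_cosh_def plain_term_def cosh_term_def)

lemma S_sinh_at_0: "\<gamma> \<noteq> 0 \<Longrightarrow> S_sinh m \<gamma> 0 = 0"
  by (simp add: S_sinh_def sinh_term_def)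

lemma S_cosh_exponent_0: "S_cosh m 0 = S_plain m"
  by (intro ext) (simp add: S_plain_def S_cosh_def plain_term_def cosh_term_def cong: if_cong)

lemma S_sinh_exponent_0: "S_sinh m 0 = S_plain m"
  by (intro ext) (simp add: S_plain_def S_sinh_def plain_term_def sinh_term_def cong: if_cong)

end

theory Submission
  imports Defs "HOL-Complex_Analysis.Cauchy_Integral_Formula"
begin

text \<open>
  All three summands are instances of one expression. With \<open>q\<^sub>n(\<phi>) = \<phi> / sinh (n\<phi>/2)\<close>, extended
  by its limit \<open>2 / n\<close> to \<open>\<phi> = 0\<close>, the summand is \<open>q\<^sub>n(\<phi>) ^ (2m+2) * h (n\<phi>) powi \<gamma>\<close>, where \<open>h\<close> is
  \<open>cosh\<close> or \<open>sinh\<close>; the plain series is the case \<open>\<gamma> = 0\<close>.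

  In the variable \<open>z = n\<phi>/2\<close> the summand equals \<open>(2/n) ^ (2m+2)\<close> times
  \<open>z ^ (2m+2) * h (2z) powi \<gamma> / sinh z ^ (2m+2)\<close>, so it suffices to bound the second factor: the
  series is then dominated by a multiple of \<open>\<Sum> n powr -(2m+2)\<close>, which converges. On a double sector
  \<open>\<bar>z\<bar> \<le> L * \<bar>Re z\<bar>\<close> everything is controlled by \<open>r = Re z\<close>, because
  \<open>\<bar>sinh r\<bar> \<le> \<bar>h z\<bar> \<le> cosh r\<close>. The growth \<open>cosh (2r) ^ m\<close>, of order \<open>exp (2m\<bar>r\<bar>)\<close>, is beaten by
  \<open>sinh r ^ (2m+2)\<close> with a factor \<open>exp (2\<bar>r\<bar>)\<close> to spare, which absorbs \<open>r ^ (2m+2)\<close>; this is where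
  \<open>\<gamma> < m + 1\<close> enters (\<open>power_cosh_le_sinh\<close>). For negative \<open>\<gamma>\<close> a lower bound on \<open>\<bar>h (n\<phi>)\<bar>\<close> is used
  instead: it is at least \<open>sinh a\<close> when \<open>\<bar>Re \<phi>\<bar> \<ge> a\<close>, and \<open>cosh\<close> is at least \<open>1\<close> on the whole real axis.

  The domination is uniform on the real axis, where \<open>L = 1\<close>, and on small closed discs off the
  imaginary axis. By the Weierstrass M-test the partial sums converge uniformly there, so the
  sum is continuous on the former set and, by the Weierstrass convergence theorem for holomorphic
  functions, analytic off the imaginary axis.
\<close>

section \<open>Estimates for the hyperbolic functions\<close>

lemma power_div_fact_le_exp:
  fixes x :: real
  assumes "0 \<le> x"
  shows "x ^ k / fact k \<le> exp x"
proof -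
  have "(\<Sum>i\<in>{k}. x ^ i /\<^sub>R fact i) \<le> exp x"
    unfolding exp_def using assms by (intro sum_le_suminf summable_exp_generic) auto
  then show ?thesis
    by (simp add: field_simps)
qed

lemma abs_le_abs_sinh: "\<bar>r\<bar> \<le> \<bar>sinh r\<bar>" for r :: real
  using real_le_abs_sinh[of r] by (simp add: sinh_field_def exp_minus)

text \<open>
  If \<open>\<bar>sinh r\<bar> \<le> 1\<close>, the left side is small because \<open>\<bar>r\<bar> \<le> \<bar>sinh r\<bar>\<close> and \<open>cosh (2r) = 1 + 2 sinh\<^sup>2 r \<le> 3\<close>.
  Otherwise \<open>cosh (2r) \<le> 3 sinh\<^sup>2 r\<close>, which leaves one factor \<open>sinh\<^sup>2 r\<close>; as it grows exponentially,
  it dominates the power \<open>r ^ (2m+2)\<close>.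
\<close>
lemma power_cosh_le_sinh:
  fixes r :: real
  shows "\<bar>r\<bar> ^ (2 * m + 2) * cosh (2 * r) ^ m
    \<le> 9 * 3 ^ m * (fact (m + 1))\<^sup>2 * \<bar>sinh r\<bar> ^ (2 * m + 2)"
proof -
  define s where "s = \<bar>sinh r\<bar>"
  define K :: real where "K = 9 * (fact (m + 1))\<^sup>2"
  have s0: "0 \<le> s" and rs: "\<bar>r\<bar> \<le> s"
    using abs_le_abs_sinh by (auto simp: s_def)
  have K1: "1 \<le> K"
  proof -
    have "1 * 1 \<le> (9::real) * (fact (m + 1))\<^sup>2"
      by (intro mult_mono one_le_power fact_ge_1) auto
    then show ?thesis
      by (simp add: K_def)
  qed
  have c: "cosh (2 * r) = 1 + 2 * s\<^sup>2"
    by (simp add: s_def cosh_double cosh_square_eq)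
  have "\<bar>r\<bar> ^ (2 * m + 2) * cosh (2 * r) ^ m \<le> 3 ^ m * (K * s ^ (2 * m + 2))"
  proof (cases "s \<le> 1")
    case True
    have "\<bar>r\<bar> ^ (2 * m + 2) \<le> s ^ (2 * m + 2)"
      using rs by (intro power_mono) auto
    moreover have "cosh (2 * r) ^ m \<le> 3 ^ m"
      using power_le_one[OF s0 True, of 2] by (intro power_mono) (auto simp: c)
    ultimately have "\<bar>r\<bar> ^ (2 * m + 2) * cosh (2 * r) ^ m \<le> s ^ (2 * m + 2) * 3 ^ m"
      by (rule mult_mono) (use s0 in auto)
    also have "\<dots> \<le> 3 ^ m * (K * s ^ (2 * m + 2))"
      using mult_right_mono[OF K1, of "3 ^ m * s ^ (2 * m + 2)"] s0 by (simp add: algebra_simps)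
    finally show ?thesis .
  next
    case False
    \<comment> \<open>Since \<open>cosh r \<le> s + 1\<close> and \<open>s > 1\<close>, the exponential \<open>exp \<bar>r\<bar>\<close> is at most \<open>3 * s\<close>, so a bound
      on \<open>r ^ (m+1)\<close> by the exponential series, once squared, gives one on \<open>r ^ (2m+2)\<close> by \<open>s\<^sup>2\<close>.\<close>
    have "cosh r \<le> s + 1"
    proof (rule power2_le_imp_le)
      show "(cosh r)\<^sup>2 \<le> (s + 1)\<^sup>2"
        using s0 by (simp add: s_def cosh_square_eq power2_sum)
    qed (use s0 in auto)
    moreover have "exp \<bar>r\<bar> = s + cosh r"
      using sinh_plus_cosh[of "\<bar>r\<bar>"] by (simp add: s_def)
    ultimately have "exp \<bar>r\<bar> \<le> 3 * s"
      using False by simp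
    then have "\<bar>r\<bar> ^ (m + 1) / fact (m + 1) \<le> 3 * s"
      using power_div_fact_le_exp[of "\<bar>r\<bar>" "m + 1"] by linarith
    then have "\<bar>r\<bar> ^ (m + 1) \<le> 3 * s * fact (m + 1)"
      by (simp add: divide_le_eq del: fact_Suc)
    then have "(\<bar>r\<bar> ^ (m + 1))\<^sup>2 \<le> (3 * s * fact (m + 1))\<^sup>2"
      by (rule power_mono) auto
    then have r: "\<bar>r\<bar> ^ (2 * m + 2) \<le> K * s\<^sup>2"
      by (simp add: K_def power_mult_distrib mult_ac flip: power_mult del: fact_Suc power_Suc)
    have "1 \<le> s\<^sup>2"
      using False by (simp add: one_le_power)
    then have "cosh (2 * r) ^ m \<le> (3 * s\<^sup>2) ^ m"
      by (intro power_mono) (auto simp: c)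
    with r have "\<bar>r\<bar> ^ (2 * m + 2) * cosh (2 * r) ^ m \<le> K * s\<^sup>2 * (3 * s\<^sup>2) ^ m"
      by (rule mult_mono) (use K1 in auto)
    also have "\<dots> = 3 ^ m * (K * s ^ (2 * m + 2))"
      by (simp add: power_mult_distrib power_add power_mult power2_eq_square)
    finally show ?thesis .
  qed
  then show ?thesis
    by (simp add: K_def s_def mult_ac)
qed

lemma sinh_Re_le_norm_sinh: "\<bar>sinh (Re z)\<bar> \<le> norm (sinh z)"
  using norm_triangle_ineq3[of "exp z" "exp (- z)"]
  by (simp add: sinh_field_def norm_divide)

lemma sinh_Re_le_norm_cosh: "\<bar>sinh (Re z)\<bar> \<le> norm (cosh z)"
  using norm_triangle_ineq3[of "exp z" "- exp (- z)"]
  by (simp add: sinh_field_def cosh_field_def norm_divide)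

lemma norm_sinh_le_cosh_Re: "norm (sinh z) \<le> cosh (Re z)" for z :: complex
  using norm_triangle_ineq4[of "exp z" "exp (- z)"]
  by (simp add: sinh_field_def cosh_field_def norm_divide)

lemma norm_cosh_le_cosh_Re: "norm (cosh z) \<le> cosh (Re z)" for z :: complex
  using norm_triangle_ineq[of "exp z" "exp (- z)"]
  by (simp add: cosh_field_def norm_divide)

text \<open>
  Replacing \<open>\<gamma>\<close> by the larger exponent \<open>m\<close> is harmless since \<open>A \<ge> 1\<close>; only a negative power
  needs a lower bound on \<open>\<bar>w\<bar>\<close>.
\<close>
lemma norm_power_int_le:
  fixes w :: complex
  assumes "norm w \<le> A" "1 \<le> A" "\<gamma> \<le> int m" and b: "\<gamma> < 0 \<Longrightarrow> 0 < b \<and> b \<le> norm w"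
  shows "norm (w powi \<gamma>) \<le> max 1 (b powi \<gamma>) * A ^ m"
proof (cases "\<gamma> < 0")
  case True
  with b have "b ^ nat (- \<gamma>) \<le> norm w ^ nat (- \<gamma>)" "0 < b ^ nat (- \<gamma>)"
    by (auto intro: power_mono)
  then have "norm (w powi \<gamma>) \<le> b powi \<gamma>"
    using True by (simp add: power_int_def power_inverse norm_inverse norm_power le_imp_inverse_le)
  also have "\<dots> \<le> max 1 (b powi \<gamma>) * 1"
    by simp
  also have "\<dots> \<le> max 1 (b powi \<gamma>) * A ^ m"
    by (intro mult_left_mono one_le_power assms) auto
  finally show ?thesis .
next
  case False
  have "norm (w powi \<gamma>) = norm w ^ nat \<gamma>"
    using False by (simp add: norm_power_int power_int_def norm_power)
  also have "\<dots> \<le> A ^ nat \<gamma>"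
    by (intro power_mono assms) auto
  also have "\<dots> \<le> A ^ m"
    by (intro power_increasing assms) (use \<open>\<gamma> \<le> int m\<close> in auto)
  also have "\<dots> \<le> max 1 (b powi \<gamma>) * A ^ m"
    using assms mult_right_mono[of 1 "max 1 (b powi \<gamma>)" "A ^ m"] by auto
  finally show ?thesis .
qed

section \<open>The common form of the summands\<close>

definition sinh_quotient :: "nat \<Rightarrow> complex \<Rightarrow> complex" where
  "sinh_quotient n \<phi> = (if \<phi> = 0 then 2 / of_nat n else \<phi> / sinh (of_nat n * \<phi> / 2))"

text \<open>
  At \<open>\<phi> = 0\<close> the prescribed values agree with this form for every \<open>\<gamma>\<close>: a negative power of
  \<open>sinh 0 = 0\<close> is \<open>0\<close> by the convention on division.
\<close>
definition hyperbolic_term :: "(complex \<Rightarrow> complex) \<Rightarrow> nat \<Rightarrow> int \<Rightarrow> nat \<Rightarrow> complex \<Rightarrow> complex" where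
  "hyperbolic_term h m \<gamma> n \<phi> = sinh_quotient n \<phi> ^ (2 * m + 2) * h (of_nat n * \<phi>) powi \<gamma>"

lemma cosh_term_eq: "cosh_term m \<gamma> = hyperbolic_term cosh m \<gamma>"
  by (intro ext) (simp add: cosh_term_def hyperbolic_term_def sinh_quotient_def power_divide)

lemma sinh_term_eq: "sinh_term m \<gamma> = hyperbolic_term sinh m \<gamma>"
  by (intro ext)
    (simp add: sinh_term_def hyperbolic_term_def sinh_quotient_def power_divide power_int_0_left_if)

lemma plain_term_eq: "plain_term m n = cosh_term m 0 n"
  by (intro ext) (simp add: plain_term_def cosh_term_def cong: if_cong)

lemma sinh_nonzero:
  assumes "Re \<phi> \<noteq> 0" "0 < n"
  shows "sinh (of_nat n * \<phi> / 2) \<noteq> 0"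
proof -
  have "0 < \<bar>sinh (Re (of_nat n * \<phi> / 2))\<bar>"
    using assms by simp
  also have "\<dots> \<le> norm (sinh (of_nat n * \<phi> / 2))"
    by (rule sinh_Re_le_norm_sinh)
  finally show ?thesis
    by simp
qed

text \<open>
  Off \<open>0\<close> the function is the reciprocal of the difference quotient of \<open>sinh (n z / 2)\<close> at \<open>0\<close>,
  and the derivative there is \<open>n / 2\<close>.
\<close>
lemma isCont_sinh_quotient_0:
  assumes "0 < n"
  shows "isCont (sinh_quotient n) 0"
proof -
  have "((\<lambda>z::complex. sinh (of_nat n * z / 2)) has_field_derivative of_nat n / 2) (at 0)"
    by (auto intro!: derivative_eq_intros)
  then have "((\<lambda>z. sinh (of_nat n * z / 2) / z) \<longlongrightarrow> (of_nat n / 2 :: complex)) (at 0)"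
    by (simp add: has_field_derivative_iff)
  then have "((\<lambda>z. inverse (sinh (of_nat n * z / 2) / z)) \<longlongrightarrow> 2 / (of_nat n :: complex)) (at 0)"
    using assms tendsto_inverse[of "\<lambda>z. sinh (of_nat n * z / 2) / z" "of_nat n / 2 :: complex" "at 0"]
    by simp
  then have "(sinh_quotient n \<longlongrightarrow> 2 / of_nat n) (at 0)"
    by (rule Lim_transform_eventually) (auto simp: sinh_quotient_def eventually_at_filter)
  then show ?thesis
    by (simp add: isCont_def sinh_quotient_def)
qed

lemma holomorphic_sinh_quotient:
  assumes "0 < n"
  shows "sinh_quotient n holomorphic_on {\<phi>. Re \<phi> \<noteq> 0}"
proof -
  have "(\<lambda>\<phi>. \<phi> / sinh (of_nat n * \<phi> / 2)) holomorphic_on {\<phi>. Re \<phi> \<noteq> 0}"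
    unfolding sinh_field_def
    by (intro holomorphic_intros) (use sinh_nonzero assms in \<open>auto simp: sinh_field_def\<close>)
  then show ?thesis
    by (rule holomorphic_transform) (auto simp: sinh_quotient_def)
qed

lemma open_Re_nonzero: "open {\<phi>::complex. Re \<phi> \<noteq> 0}"
  by (intro open_Collect_neq continuous_intros)

lemma continuous_on_Reals_sinh_quotient:
  assumes "0 < n"
  shows "continuous_on \<real> (sinh_quotient n)"
proof (intro continuous_at_imp_continuous_on ballI)
  fix \<phi> :: complex assume "\<phi> \<in> \<real>"
  show "isCont (sinh_quotient n) \<phi>"
  proof (cases "\<phi> = 0")
    case False
    with \<open>\<phi> \<in> \<real>\<close> have "\<phi> \<in> {\<phi>. Re \<phi> \<noteq> 0}"
      by (auto elim!: Reals_cases)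
    then show ?thesis
      using holomorphic_on_imp_continuous_on[OF holomorphic_sinh_quotient[OF assms]]
        continuous_on_eq_continuous_at[OF open_Re_nonzero] by blast
  qed (simp add: isCont_sinh_quotient_0 assms)
qed

lemma holomorphic_hyperbolic_term:
  assumes "0 < n" and h: "h holomorphic_on UNIV" "\<And>z. \<bar>sinh (Re z)\<bar> \<le> norm (h z)"
  shows "hyperbolic_term h m \<gamma> n holomorphic_on {\<phi>. Re \<phi> \<noteq> 0}"
proof -
  have "h (of_nat n * \<phi>) \<noteq> 0" if "Re \<phi> \<noteq> 0" for \<phi>
  proof -
    have "0 < \<bar>sinh (Re (of_nat n * \<phi>))\<bar>"
      using assms(1) that by simp
    then show ?thesis
      using h(2)[of "of_nat n * \<phi>"] by auto
  qed
  moreover have "(\<lambda>\<phi>. h (of_nat n * \<phi>)) holomorphic_on {\<phi>. Re \<phi> \<noteq> 0}"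
    by (rule holomorphic_on_compose_gen[OF _ h(1), unfolded o_def]) (auto intro!: holomorphic_intros)
  ultimately show ?thesis
    unfolding hyperbolic_term_def
    by (intro holomorphic_intros holomorphic_sinh_quotient assms) auto
qed

section \<open>Domination of the series\<close>

definition majorant :: "real \<Rightarrow> nat \<Rightarrow> nat \<Rightarrow> real" where
  "majorant C m n = C * (2 / real n) ^ (2 * m + 2)"

lemma summable_majorant: "summable (\<lambda>n. majorant C m (Suc n))"
proof -
  have "summable (\<lambda>n. inverse (real n ^ (2 * m + 2)))"
    by (rule inverse_power_summable) simp
  then have "summable (\<lambda>n. C * 2 ^ (2 * m + 2) * inverse (real (Suc n) ^ (2 * m + 2)))"
    by (intro summable_mult) (subst summable_Suc_iff)
  then show ?thesis
    by (simp add: majorant_def power_divide divide_inverse mult_ac power_inverse del: power_Suc of_nat_Suc)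
qed

text \<open>
  The factor \<open>L ^ (2m+2)\<close> is the price for replacing \<open>\<bar>\<phi>\<bar>\<close> by \<open>\<bar>Re \<phi>\<bar>\<close>; what remains is the
  real estimate at \<open>r = n * Re \<phi> / 2\<close>.
\<close>
lemma norm_hyperbolic_term_le:
  assumes n: "0 < n" and L: "1 \<le> L" "norm \<phi> \<le> L * \<bar>Re \<phi>\<bar>"
    and C: "norm (h (of_nat n * \<phi>) powi \<gamma>) \<le> C * cosh (real n * Re \<phi>) ^ m"
  shows "norm (hyperbolic_term h m \<gamma> n \<phi>)
    \<le> majorant (C * L ^ (2 * m + 2) * (9 * 3 ^ m * (fact (m + 1))\<^sup>2)) m n"
proof -
  define N where "N = 2 * m + 2"
  define K :: real where "K = 9 * 3 ^ m * (fact (m + 1))\<^sup>2"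
  define r where "r = real n * Re \<phi> / 2"
  have C0: "0 \<le> C"
  proof -
    have "0 < cosh (real n * Re \<phi>) ^ m"
      by simp
    then show ?thesis
      using order_trans[OF norm_ge_zero C] by (metis zero_le_mult_iff not_le)
  qed
  have K1: "1 \<le> K"
  proof -
    have "1 * 1 * 1 \<le> (9::real) * 3 ^ m * (fact (m + 1))\<^sup>2"
      by (intro mult_mono one_le_power fact_ge_1) auto
    then show ?thesis
      by (simp add: K_def)
  qed
  have q: "norm (sinh_quotient n \<phi>) ^ N * cosh (2 * r) ^ m \<le> L ^ N * K * (2 / real n) ^ N"
  proof (cases "\<phi> = 0")
    case True
    have "1 * 1 \<le> L ^ N * K"
      by (intro mult_mono one_le_power L K1) (use L in auto)
    then show ?thesis
      using True mult_right_mono[of 1 "L ^ N * K" "(2 / real n) ^ N"]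
      by (simp add: sinh_quotient_def r_def norm_divide)
  next
    case False
    with L have "Re \<phi> \<noteq> 0"
      by auto
    with n have s: "0 < \<bar>sinh r\<bar>"
      by (simp add: r_def)
    have "norm (sinh_quotient n \<phi>) = norm \<phi> / norm (sinh (of_nat n * \<phi> / 2))"
      using False by (simp add: sinh_quotient_def norm_divide)
    also have "\<dots> \<le> L * \<bar>Re \<phi>\<bar> / \<bar>sinh r\<bar>"
      using sinh_Re_le_norm_sinh[of "of_nat n * \<phi> / 2"] s L by (intro frac_le) (auto simp: r_def)
    also have "\<dots> = L * (2 / real n) * \<bar>r\<bar> / \<bar>sinh r\<bar>"
      using n by (simp add: r_def abs_mult)
    finally have "norm (sinh_quotient n \<phi>) ^ N \<le> (L * (2 / real n) * \<bar>r\<bar> / \<bar>sinh r\<bar>) ^ N"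
      by (rule power_mono) auto
    then have "norm (sinh_quotient n \<phi>) ^ N * cosh (2 * r) ^ m
        \<le> (L * (2 / real n) * \<bar>r\<bar> / \<bar>sinh r\<bar>) ^ N * cosh (2 * r) ^ m"
      by (rule mult_right_mono) auto
    also have "\<dots> = (L * (2 / real n)) ^ N * (\<bar>r\<bar> ^ N * cosh (2 * r) ^ m / \<bar>sinh r\<bar> ^ N)"
      by (simp add: power_mult_distrib power_divide)
    also have "\<dots> \<le> (L * (2 / real n)) ^ N * K"
    proof (rule mult_left_mono)
      show "\<bar>r\<bar> ^ N * cosh (2 * r) ^ m / \<bar>sinh r\<bar> ^ N \<le> K"
        using power_cosh_le_sinh[of r m] s by (simp add: N_def K_def divide_le_eq del: power_Suc fact_Suc)
    qed (use L in auto)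
    also have "\<dots> = L ^ N * K * (2 / real n) ^ N"
      unfolding power_mult_distrib by (simp only: mult_ac)
    finally show ?thesis .
  qed
  have "norm (hyperbolic_term h m \<gamma> n \<phi>)
      \<le> norm (sinh_quotient n \<phi>) ^ N * (C * cosh (2 * r) ^ m)"
    using mult_left_mono[OF C, of "norm (sinh_quotient n \<phi>) ^ N"]
    by (simp add: hyperbolic_term_def N_def r_def norm_mult norm_power del: power_Suc)
  also have "\<dots> \<le> C * (L ^ N * K * (2 / real n) ^ N)"
    using mult_left_mono[OF q C0] by (simp add: mult_ac)
  finally show ?thesis
    by (simp add: majorant_def N_def K_def mult_ac)
qed

text \<open>
  On a disc around \<open>\<phi>\<^sub>0\<close> of radius \<open>\<bar>Re \<phi>\<^sub>0\<bar> / 2\<close> the real part stays away from \<open>0\<close>, which gives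
  both an aperture \<open>L\<close> and the lower bound on \<open>\<bar>h\<bar>\<close> for negative exponents.
\<close>
lemma dominated_near_off_axis:
  assumes h: "\<And>z. \<bar>sinh (Re z)\<bar> \<le> norm (h z)" "\<And>z. norm (h z) \<le> cosh (Re z)"
    and "\<gamma> \<le> int m" "Re \<phi>\<^sub>0 \<noteq> 0"
  shows "\<exists>d>0. cball \<phi>\<^sub>0 d \<subseteq> {\<phi>. Re \<phi> \<noteq> 0} \<and>
    (\<exists>C. \<forall>n>0. \<forall>\<phi>\<in>cball \<phi>\<^sub>0 d. norm (hyperbolic_term h m \<gamma> n \<phi>) \<le> majorant C m n)"
proof -
  define a where "a = \<bar>Re \<phi>\<^sub>0\<bar> / 2"
  have a: "0 < a"
    using assms by (simp add: a_def)
  have Re_ge: "a \<le> \<bar>Re \<phi>\<bar>" if "\<phi> \<in> cball \<phi>\<^sub>0 a" for \<phi>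
    using that abs_Re_le_cmod[of "\<phi>\<^sub>0 - \<phi>"] by (simp add: dist_norm a_def)
  define L where "L = 1 + (norm \<phi>\<^sub>0 + a) / a"
  have L: "1 \<le> L"
    using a by (simp add: L_def)
  show ?thesis
  proof (intro exI conjI allI ballI impI)
    show "0 < a" by (fact a)
    show "cball \<phi>\<^sub>0 a \<subseteq> {\<phi>. Re \<phi> \<noteq> 0}"
      using Re_ge a by force
    fix n :: nat and \<phi> assume n: "0 < n" and \<phi>: "\<phi> \<in> cball \<phi>\<^sub>0 a"
    have "norm \<phi> \<le> norm \<phi>\<^sub>0 + a"
      using \<phi> norm_triangle_ineq2[of \<phi> \<phi>\<^sub>0] by (simp add: dist_norm norm_minus_commute)
    also have "\<dots> \<le> L * a"
      using a by (simp add: L_def field_simps)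
    also have "\<dots> \<le> L * \<bar>Re \<phi>\<bar>"
      using Re_ge[OF \<phi>] L by (intro mult_left_mono) auto
    finally have *: "norm \<phi> \<le> L * \<bar>Re \<phi>\<bar>" .
    have "a \<le> real n * \<bar>Re \<phi>\<bar>"
      using Re_ge[OF \<phi>] n a mult_mono[of 1 "real n" a "\<bar>Re \<phi>\<bar>"] by auto
    then have "sinh a \<le> sinh \<bar>real n * Re \<phi>\<bar>"
      by (simp add: abs_mult del: sinh_real_abs)
    also have "\<dots> \<le> norm (h (of_nat n * \<phi>))"
      using h(1)[of "of_nat n * \<phi>"] by simp
    finally have "norm (h (of_nat n * \<phi>) powi \<gamma>)
        \<le> max 1 (sinh a powi \<gamma>) * cosh (real n * Re \<phi>) ^ m"
      using assms(3) a h(2)[of "of_nat n * \<phi>"]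
      by (intro norm_power_int_le) (auto simp: cosh_real_ge_1)
    from norm_hyperbolic_term_le[where h = h, OF n L * this]
    show "norm (hyperbolic_term h m \<gamma> n \<phi>) \<le> majorant (max 1 (sinh a powi \<gamma>) * L ^ (2 * m + 2) *
        (9 * 3 ^ m * (fact (m + 1))\<^sup>2)) m n" .
  qed
qed

text \<open>
  On the real axis the domination is global. The condition on \<open>h\<close> for negative exponents is met
  by \<open>cosh\<close>.
\<close>
lemma dominated_on_Reals:
  assumes h: "\<And>z. norm (h z) \<le> cosh (Re z)" "\<And>z. \<gamma> < 0 \<Longrightarrow> z \<in> \<real> \<Longrightarrow> 1 \<le> norm (h z)"
    and "\<gamma> \<le> int m" "0 < n" "\<phi> \<in> \<real>"
  shows "norm (hyperbolic_term h m \<gamma> n \<phi>) \<le> majorant (9 * 3 ^ m * (fact (m + 1))\<^sup>2) m n"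
proof -
  have "norm (h (of_nat n * \<phi>) powi \<gamma>) \<le> max 1 (1 powi \<gamma>) * cosh (real n * Re \<phi>) ^ m"
    using assms h(1)[of "of_nat n * \<phi>"]
    by (intro norm_power_int_le) (auto simp: cosh_real_ge_1)
  moreover have "norm \<phi> \<le> 1 * \<bar>Re \<phi>\<bar>"
    using \<open>\<phi> \<in> \<real>\<close> by (auto elim!: Reals_cases)
  ultimately show ?thesis
    using norm_hyperbolic_term_le[of n 1 \<phi> h \<gamma> 1 m] assms by simp
qed

section \<open>Analyticity and continuity of the sums\<close>

lemma summable_hyperbolic_term:
  assumes "\<And>n. 0 < n \<Longrightarrow> norm (hyperbolic_term h m \<gamma> n \<phi>) \<le> majorant C m n"
  shows "summable (\<lambda>n. hyperbolic_term h m \<gamma> (Suc n) \<phi>)"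
  by (rule summable_comparison_test'[OF summable_majorant[of C m]]) (use assms in auto)

lemma uniform_limit_hyperbolic_series:
  assumes "\<And>n \<phi>. 0 < n \<Longrightarrow> \<phi> \<in> A \<Longrightarrow> norm (hyperbolic_term h m \<gamma> n \<phi>) \<le> majorant C m n"
  shows "uniform_limit A (\<lambda>N \<phi>. \<Sum>n<N. hyperbolic_term h m \<gamma> (Suc n) \<phi>)
    (\<lambda>\<phi>. \<Sum>n. hyperbolic_term h m \<gamma> (Suc n) \<phi>) sequentially"
  by (rule Weierstrass_m_test[OF _ summable_majorant]) (use assms in auto)

text \<open>
  The lower bound on \<open>\<bar>h\<bar>\<close> keeps the zeros of \<open>h\<close> on the imaginary axis, so negative powers are
  holomorphic off it.
\<close>
lemma off_axis:
  assumes h: "h holomorphic_on UNIV" "\<And>z. \<bar>sinh (Re z)\<bar> \<le> norm (h z)" "\<And>z. norm (h z) \<le> cosh (Re z)"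
    and "\<gamma> \<le> int m"
  shows summable_off_axis: "Re \<phi> \<noteq> 0 \<Longrightarrow> summable (\<lambda>n. hyperbolic_term h m \<gamma> (Suc n) \<phi>)"
    and analytic_off_axis: "(\<lambda>\<phi>. \<Sum>n. hyperbolic_term h m \<gamma> (Suc n) \<phi>) analytic_on {\<phi>. Re \<phi> \<noteq> 0}"
proof -
  note dom = dominated_near_off_axis[of h, OF h(2,3) assms(4)]
  show "summable (\<lambda>n. hyperbolic_term h m \<gamma> (Suc n) \<phi>)" if \<phi>: "Re \<phi> \<noteq> 0"
  proof -
    obtain d C where "d > 0" "\<And>n. 0 < n \<Longrightarrow> \<forall>\<psi>\<in>cball \<phi> d. norm (hyperbolic_term h m \<gamma> n \<psi>) \<le> majorant C m n"
      using dom[OF \<phi>] by auto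
    then show ?thesis
      by (intro summable_hyperbolic_term[where C = C]) auto
  qed
  have "(\<lambda>\<phi>. \<Sum>n. hyperbolic_term h m \<gamma> (Suc n) \<phi>) holomorphic_on {\<phi>. Re \<phi> \<noteq> 0}"
  proof (rule holomorphic_uniform_sequence[OF open_Re_nonzero])
    show "(\<lambda>\<phi>. \<Sum>n<N. hyperbolic_term h m \<gamma> (Suc n) \<phi>) holomorphic_on {\<phi>. Re \<phi> \<noteq> 0}" for N
      by (intro holomorphic_intros holomorphic_hyperbolic_term h) auto
    fix \<phi> assume "\<phi> \<in> {\<phi>. Re \<phi> \<noteq> 0}"
    then obtain d C where "d > 0" "cball \<phi> d \<subseteq> {\<phi>. Re \<phi> \<noteq> 0}"
      "\<And>n. 0 < n \<Longrightarrow> \<forall>\<psi>\<in>cball \<phi> d. norm (hyperbolic_term h m \<gamma> n \<psi>) \<le> majorant C m n"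
      using dom[of \<phi>] by auto
    then show "\<exists>d>0. cball \<phi> d \<subseteq> {\<phi>. Re \<phi> \<noteq> 0} \<and> uniform_limit (cball \<phi> d)
        (\<lambda>N \<phi>. \<Sum>n<N. hyperbolic_term h m \<gamma> (Suc n) \<phi>) (\<lambda>\<phi>. \<Sum>n. hyperbolic_term h m \<gamma> (Suc n) \<phi>) sequentially"
      by (intro exI[of _ d] conjI uniform_limit_hyperbolic_series[where C = C]) auto
  qed
  then show "(\<lambda>\<phi>. \<Sum>n. hyperbolic_term h m \<gamma> (Suc n) \<phi>) analytic_on {\<phi>. Re \<phi> \<noteq> 0}"
    by (simp add: analytic_on_open open_Re_nonzero)
qed

lemma on_Reals:
  assumes h: "continuous_on \<real> h" "\<And>z. norm (h z) \<le> cosh (Re z)"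
      "\<And>z. \<gamma> < 0 \<Longrightarrow> z \<in> \<real> \<Longrightarrow> 1 \<le> norm (h z)"
    and "\<gamma> \<le> int m"
  shows summable_on_Reals: "\<phi> \<in> \<real> \<Longrightarrow> summable (\<lambda>n. hyperbolic_term h m \<gamma> (Suc n) \<phi>)"
    and continuous_on_Reals: "continuous_on \<real> (\<lambda>\<phi>. \<Sum>n. hyperbolic_term h m \<gamma> (Suc n) \<phi>)"
proof -
  note dom = dominated_on_Reals[of h, OF h(2,3) assms(4)]
  show "\<phi> \<in> \<real> \<Longrightarrow> summable (\<lambda>n. hyperbolic_term h m \<gamma> (Suc n) \<phi>)"
    by (rule summable_hyperbolic_term) (rule dom)
  have "continuous_on \<real> (hyperbolic_term h m \<gamma> (Suc n))" for n
  proof -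
    have hn: "continuous_on \<real> (\<lambda>\<phi>. h (of_nat (Suc n) * \<phi>))"
      by (intro continuous_on_compose2[OF h(1)] continuous_intros) auto
    have "continuous_on \<real> (\<lambda>\<phi>. h (of_nat (Suc n) * \<phi>) powi \<gamma>)"
    proof (cases "\<gamma> < 0")
      case True
      then have "h (of_nat (Suc n) * \<phi>) \<noteq> 0" if "\<phi> \<in> \<real>" for \<phi>
        using h(3)[of "of_nat (Suc n) * \<phi>"] that by (auto simp del: of_nat_Suc)
      then show ?thesis
        using hn by (intro continuous_intros) auto
    next
      case False
      with hn show ?thesis
        by (simp add: power_int_def continuous_on_power del: of_nat_Suc)
    qed
    then show ?thesis
      unfolding hyperbolic_term_def
      by (intro continuous_on_mult continuous_on_power continuous_on_Reals_sinh_quotient) auto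
  qed
  then show "continuous_on \<real> (\<lambda>\<phi>. \<Sum>n. hyperbolic_term h m \<gamma> (Suc n) \<phi>)"
    by (intro uniform_limit_theorem[OF _ uniform_limit_hyperbolic_series[OF dom]]
        always_eventually allI continuous_on_sum) auto
qed

lemma holomorphic_cosh: "cosh holomorphic_on (A :: complex set)"
  unfolding cosh_field_def[abs_def] by (intro holomorphic_intros) auto

lemma holomorphic_sinh: "sinh holomorphic_on (A :: complex set)"
  unfolding sinh_field_def[abs_def] by (intro holomorphic_intros) auto

lemma one_le_norm_cosh_real: "1 \<le> norm (cosh z)" if z: "z \<in> \<real>" for z :: complex
proof -
  obtain x where "z = of_real x"
    using z by (rule Reals_cases)
  then have "cosh z = of_real (cosh x)"
    by (simp add: cosh_field_def exp_of_real flip: of_real_minus of_real_exp)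
  then show ?thesis
    by (simp add: cosh_real_ge_1)
qed

theorem proposition2p9:
  fixes m :: nat and \<gamma> :: int
  assumes "\<gamma> < int m + 1"
  shows "(\<forall>\<phi>. Re \<phi> \<noteq> 0 \<or> \<phi> \<in> \<real> \<longrightarrow>
            summable (\<lambda>n. cosh_term m \<gamma> (Suc n) \<phi>) \<and>
            summable (\<lambda>n. sinh_term m \<gamma> (Suc n) \<phi>) \<and>
            summable (\<lambda>n. plain_term m (Suc n) \<phi>)) \<and>
         S_cosh m \<gamma> analytic_on {\<phi>. Re \<phi> \<noteq> 0} \<and>
         S_sinh m \<gamma> analytic_on {\<phi>. Re \<phi> \<noteq> 0} \<and>
         S_plain m analytic_on {\<phi>. Re \<phi> \<noteq> 0} \<and>
         continuous_on \<real> (S_cosh m \<gamma>) \<and>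
         continuous_on (if \<gamma> < 0 then \<real> - {0} else \<real>) (S_sinh m \<gamma>) \<and>
         continuous_on \<real> (S_plain m)"
proof -
  have Re_nonzero: "Re \<phi> \<noteq> 0" if "\<phi> \<in> \<real>" "\<phi> \<noteq> 0" for \<phi>
    using that by (auto elim!: Reals_cases)
  have cosh: "summable (\<lambda>n. cosh_term m \<delta> (Suc n) \<phi>)"
    if "\<delta> \<le> int m" "Re \<phi> \<noteq> 0 \<or> \<phi> \<in> \<real>" for \<delta> \<phi>
    using that summable_off_axis[OF holomorphic_cosh sinh_Re_le_norm_cosh norm_cosh_le_cosh_Re]
      summable_on_Reals[OF holomorphic_on_imp_continuous_on[OF holomorphic_cosh]
        norm_cosh_le_cosh_Re one_le_norm_cosh_real]
    unfolding cosh_term_eq by blast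
  have cosh_analytic: "S_cosh m \<delta> analytic_on {\<phi>. Re \<phi> \<noteq> 0}" if "\<delta> \<le> int m" for \<delta>
    unfolding S_cosh_def[abs_def] cosh_term_eq
    by (intro analytic_off_axis holomorphic_cosh sinh_Re_le_norm_cosh norm_cosh_le_cosh_Re that)
  have cosh_continuous: "continuous_on \<real> (S_cosh m \<delta>)" if "\<delta> \<le> int m" for \<delta>
    unfolding S_cosh_def[abs_def] cosh_term_eq
    by (intro continuous_on_Reals holomorphic_on_imp_continuous_on[OF holomorphic_cosh]
        norm_cosh_le_cosh_Re one_le_norm_cosh_real that)
  have \<gamma>: "\<gamma> \<le> int m"
    using assms by simp
  have sinh_analytic: "S_sinh m \<gamma> analytic_on {\<phi>. Re \<phi> \<noteq> 0}"
    unfolding S_sinh_def[abs_def] sinh_term_eq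
    by (intro analytic_off_axis holomorphic_sinh sinh_Re_le_norm_sinh norm_sinh_le_cosh_Re \<gamma>)
  have sinh: "summable (\<lambda>n. sinh_term m \<gamma> (Suc n) \<phi>)" if \<phi>: "Re \<phi> \<noteq> 0 \<or> \<phi> \<in> \<real>" for \<phi>
  proof (cases "\<gamma> < 0 \<and> \<phi> = 0")
    case True
    then show ?thesis
      by (simp add: sinh_term_def)
  next
    case False
    then show ?thesis
      using \<phi> Re_nonzero[of \<phi>] \<gamma>
        summable_off_axis[OF holomorphic_sinh sinh_Re_le_norm_sinh norm_sinh_le_cosh_Re \<gamma>, of \<phi>]
        summable_on_Reals[OF holomorphic_on_imp_continuous_on[OF holomorphic_sinh]
          norm_sinh_le_cosh_Re _ \<gamma>, of \<phi>]
      unfolding sinh_term_eq by (cases "\<gamma> < 0") auto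
  qed
  have sinh_continuous: "continuous_on (if \<gamma> < 0 then \<real> - {0} else \<real>) (S_sinh m \<gamma>)"
  proof (cases "\<gamma> < 0")
    case True
    have "continuous_on (\<real> - {0}) (S_sinh m \<gamma>)"
      by (rule continuous_on_subset[OF holomorphic_on_imp_continuous_on
            [OF analytic_imp_holomorphic[OF sinh_analytic]]]) (use Re_nonzero in auto)
    with True show ?thesis
      by simp
  next
    case False
    have "continuous_on \<real> (S_sinh m \<gamma>)"
      unfolding S_sinh_def[abs_def] sinh_term_eq
      by (intro continuous_on_Reals holomorphic_on_imp_continuous_on[OF holomorphic_sinh]
          norm_sinh_le_cosh_Re \<gamma>) (use False in auto)
    with False show ?thesis
      by simp
  qed
  have plain: "summable (\<lambda>n. plain_term m (Suc n) \<phi>)" if "Re \<phi> \<noteq> 0 \<or> \<phi> \<in> \<real>" for \<phi>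
    unfolding plain_term_eq by (intro cosh that) simp
  show ?thesis
    using cosh[OF \<gamma>] sinh plain cosh_analytic[OF \<gamma>] sinh_analytic cosh_continuous[OF \<gamma>] sinh_continuous
      cosh_analytic[of 0] cosh_continuous[of 0]
    by (simp add: S_cosh_exponent_0)
qed

end
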